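(* Let $v\in\mathfrak{S}_n$, let $1\le i<j\le n$, and let $\overline{v}:=v\,(i\,j)$. Set $m:=\min\{v(i),v(j)\}$ and $M:=\max\{v(i),v(j)\}$. Then $D_o(v)=D_o(\overline{v})$ (i.e. the Bruhat edge $v\leftrightarrow\overline{v}$ is legal) if and only if all of the following hold: (R1) $i$ and $j$ have the same parity; (R2) $v(x)<m$ for all $x\in\{i+1,i+3,\dots,j-1\}$; (R3) $v(y)\notin[m,M]$ for all $y\in\{j+1,j+3,\dots\}$ with $y\le n$.
   Context: $\mathfrak{S}_n$ is the symmetric group on $[n]=\{1,\dots,n\}$. For a transposition $(i\,j)$, the product $v\,(i\,j)$ is the permutation obtained from $v$ by exchanging the values in positions $i$ and $j$, i.e. $(v(i\,j))(i)=v(j)$ and $(v(i\,j))(j)=v(i)$. The diagram of $w\in\mathfrak{S}_n$ is $D(w)=\{(a,b)\in[n]^2 : b<w(a),\ w^{-1}(b)>a\}$, and the odd diagram of $w$ is $D_o(w)=\{(a,b)\in D(w): a\not\equiv w^{-1}(b) \pmod 2\}$. Two permutations that differ by right multiplication by a transposition form a Bruhat edge; the edge is called legal if the two permutations have the same odd diagram. *)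

theory Defs
  imports "HOL-Combinatorics.Permutations"
begin

text \<open>A permutation of \<open>[n]\<close> is a function \<open>w\<close> with \<open>w permutes {1..n}\<close>. It is the identity outside
  \<open>{1..n}\<close>, so the total inverse \<open>inv w\<close> restricts to the inverse on \<open>{1..n}\<close>.\<close>

definition diagram :: "nat \<Rightarrow> (nat \<Rightarrow> nat) \<Rightarrow> (nat \<times> nat) set" where
  "diagram n w = {(a, b) \<in> {1..n} \<times> {1..n}. b < w a \<and> inv w b > a}"

definition odd_diagram :: "nat \<Rightarrow> (nat \<Rightarrow> nat) \<Rightarrow> (nat \<times> nat) set" where
  "odd_diagram n w = {(a, b) \<in> diagram n w. a mod 2 \<noteq> inv w b mod 2}"

end

theory Submission
  imports Defs
begin

text \<open>A cell \<open>(a, b)\<close> of the odd diagram of \<open>w\<close> is the same thing as an inversion of \<open>w\<close> between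
  the positions \<open>a < inv w b\<close> of opposite parity. Exchanging the values at \<open>i < j\<close> affects such
  an inversion only if one of the two positions is \<open>i\<close> or \<open>j\<close>, and so the two odd diagrams can
  be compared row by row and column by column. Take \<open>v i < v j\<close>; the case \<open>v i > v j\<close> is this one with
  \<open>v\<close> and \<open>v \<circ> transpose i j\<close> exchanged, since the conditions on \<open>v\<close> are the same for both.

  Each condition has a cell that is gained by the exchange if the condition fails. If \<open>i\<close> and \<open>j\<close>
  have different parity, this is \<open>(i, v i)\<close>, coming from the new inversion \<open>i < j\<close>. Now let the
  parities agree. If a position \<open>x\<close> between \<open>i\<close> and \<open>j\<close>, of the opposite parity, has \<open>v x > v i\<close>, it is \<open>(x, v i)\<close>, because
  the value \<open>v i\<close> moves from the left of \<open>x\<close> to its right. If a position \<open>y\<close> to the right of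
  \<open>j\<close>, again of the opposite parity, has \<open>v i < v y < v j\<close>, it is \<open>(i, v y)\<close>, because the value
  in row \<open>i\<close> rises past \<open>v y\<close>.

  Conversely, under the three conditions no cell changes. Rows \<open>i\<close> and \<open>j\<close> can change only in a
  column \<open>b\<close> between \<open>v i\<close> and \<open>v j\<close>, whose position lies to the right of \<open>i\<close> and has the parity
  opposite to \<open>i\<close> and \<open>j\<close>; there is no such position. Columns \<open>v i\<close> and \<open>v j\<close> can change only in
  rows between \<open>i\<close> and \<open>j\<close> of that parity, and there the value is too small to give an inversion
  with either.\<close>

text \<open>Naming a column by the position \<open>y\<close> at which \<open>v\<close> has its value lets the same column be
  followed through the exchange: the position of the value changes from \<open>y\<close> to \<open>transpose i j y\<close>.\<close>

lemma mem_odd_diagram: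
  assumes "w permutes {1..n}"
  shows "(a, w y) \<in> odd_diagram n w \<longleftrightarrow>
    a \<in> {1..n} \<and> y \<in> {1..n} \<and> a < y \<and> w y < w a \<and> a mod 2 \<noteq> y mod 2"
  using permutes_inverses(2)[OF assms] permutes_in_image[OF assms, of y]
  unfolding odd_diagram_def diagram_def by auto

lemma mem_odd_diagram_transpose:
  assumes "v permutes {1..n}" "i \<in> {1..n}" "j \<in> {1..n}"
  shows "(a, v y) \<in> odd_diagram n (v \<circ> transpose i j) \<longleftrightarrow>
    a \<in> {1..n} \<and> transpose i j y \<in> {1..n} \<and> a < transpose i j y \<and>
    v y < v (transpose i j a) \<and> a mod 2 \<noteq> transpose i j y mod 2"
proof -
  have "(v \<circ> transpose i j) permutes {1..n}"
    using assms by (intro permutes_compose permutes_swap_id)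
  from mem_odd_diagram[OF this, of a "transpose i j y"] show ?thesis by simp
qed

text \<open>Ordering the two values fixes the direction of the exchange: the failure of any condition then
  shows up as a cell that only the exchanged permutation has.\<close>

lemma odd_diagram_transpose_eq_iff_if_less:
  assumes v: "v permutes {1..n}" and "1 \<le> i" "i < j" "j \<le> n" and less: "v i < v j"
  shows "odd_diagram n v = odd_diagram n (v \<circ> transpose i j) \<longleftrightarrow>
    i mod 2 = j mod 2 \<and>
    (\<forall>x \<in> {i + 1..j - 1}. x mod 2 = (i + 1) mod 2 \<longrightarrow> v x < v i) \<and>
    (\<forall>y \<in> {j + 1..n}. y mod 2 = (j + 1) mod 2 \<longrightarrow> v y \<notin> {v i..v j})"
    (is "?D = ?D' \<longleftrightarrow> ?R1 \<and> ?R2 \<and> ?R3")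
proof
  have in_n: "i \<in> {1..n}" "j \<in> {1..n}" using assms by auto
  note mem = mem_odd_diagram[OF v] and mem' = mem_odd_diagram_transpose[OF v in_n]
  have inj: "v x = v y \<longleftrightarrow> x = y" for x y
    using permutes_inj[OF v] by (simp add: inj_eq)
  have odd: "x mod 2 = (k + 1) mod 2 \<longleftrightarrow> x mod 2 \<noteq> k mod 2" for x k :: nat
    by (cases "even x"; cases "even k")
      (auto simp: even_iff_mod_2_eq_zero odd_iff_mod_2_eq_one mod_Suc)
  {
    assume eq: "?D = ?D'"
    have ?R1
    proof (rule ccontr)
      assume "\<not> ?R1"
      then have "(i, v i) \<in> ?D'" using assms by (simp add: mem')
      then have "(i, v i) \<in> ?D" using eq by simp
      then show False by (simp add: mem)
    qed
    moreover have ?R2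
    proof (intro ballI impI, rule ccontr)
      fix x assume x: "x \<in> {i + 1..j - 1}" "x mod 2 = (i + 1) mod 2" and "\<not> v x < v i"
      then have "v i < v x" using inj[of x i] by auto
      then have "(x, v i) \<in> ?D'"
        using x \<open>?R1\<close> assms odd[of x i] by (auto simp: mem' transpose_def)
      then have "(x, v i) \<in> ?D" using eq by simp
      then show False using x by (simp add: mem)
    qed
    moreover have ?R3
    proof (intro ballI impI notI)
      fix y assume y: "y \<in> {j + 1..n}" "y mod 2 = (j + 1) mod 2" and "v y \<in> {v i..v j}"
      then have "v i < v y" "v y < v j"
        using \<open>i < j\<close> inj[of y i] inj[of y j] by (auto simp: le_less)
      then have "(i, v y) \<in> ?D'"
        using y \<open>?R1\<close> assms odd[of y j] by (auto simp: mem' transpose_def)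
      then have "(i, v y) \<in> ?D" using eq by simp
      then show False using \<open>v i < v y\<close> by (simp add: mem)
    qed
    ultimately show "?R1 \<and> ?R2 \<and> ?R3" by blast
  }
  {
    assume R: "?R1 \<and> ?R2 \<and> ?R3"
    have R2: "x \<le> i \<or> j \<le> x \<or> x mod 2 = i mod 2 \<or> v x < v i" for x
    proof -
      have "v x < v i" if "i < x" "x < j" "x mod 2 \<noteq> i mod 2"
        using R that odd[of x i] by auto
      then show ?thesis by linarith
    qed
    have R3: "y \<le> j \<or> n < y \<or> y mod 2 = i mod 2 \<or> v y < v i \<or> v j < v y" for y
    proof -
      have "v y < v i \<or> v j < v y" if "j < y" "y \<le> n" "y mod 2 \<noteq> i mod 2"
      proof -
        have "y \<in> {j + 1..n}" "y mod 2 = (j + 1) mod 2" using R that odd[of y j] by auto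
        then have "v y \<notin> {v i..v j}" using R by blast
        then show ?thesis by auto
      qed
      then show ?thesis by linarith
    qed
    have parity: "i mod 2 = j mod 2" using R by blast
    have "(a, v y) \<in> ?D \<longleftrightarrow> (a, v y) \<in> ?D'" for a y
    proof -
      consider "y = i" | "y = j" | "y \<noteq> i" "y \<noteq> j" by blast
      then show ?thesis
      proof cases
        \<comment> \<open>The column of the value \<open>v i\<close>, which moves from \<open>i\<close> to \<open>j\<close>: only the rows strictly
          between could gain a cell.\<close>
        case 1
        then show ?thesis using parity R2[of a] assms(2-5) inj[of a i] inj[of a j]
          by (cases "a = i"; cases "a = j"; cases "a < i"; auto simp: mem mem' transpose_def)
      next
        case 2
        then show ?thesis using parity R2[of a] assms(2-5) inj[of a i] inj[of a j]
          by (cases "a = i"; cases "a = j"; cases "a < i"; auto simp: mem mem' transpose_def)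
      next
        \<comment> \<open>A column whose position stays in place: only the values in rows \<open>i\<close> and \<open>j\<close> change, and
          no relevant column separates \<open>v i\<close> from \<open>v j\<close>.\<close>
        case 3
        then have y: "transpose i j y = y" "v y \<noteq> v i" "v y \<noteq> v j"
          using inj by auto
        have low_high: "v y < v i \<longleftrightarrow> v y < v j"
          if "y \<in> {1..n}" "i < y" "i mod 2 \<noteq> y mod 2"
        proof -
          have "y \<le> n" using that by simp
          then have "v y < v i \<or> v j < v y"
            using R2[of y] R3[of y] that y less \<open>y \<noteq> j\<close> by linarith
          then show ?thesis using less by linarith
        qed
        consider "a = i" | "a = j" | "a \<noteq> i" "a \<noteq> j" by blast
        then show ?thesis
        proof cases
          case 1
          then show ?thesis unfolding mem mem' using low_high y(1) in_n by auto
        next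
          case 2
          then show ?thesis
            unfolding mem mem' using low_high y(1) in_n parity \<open>i < j\<close> by auto
        next
          case 3
          then show ?thesis unfolding mem mem' using y by simp
        qed
      qed
    qed
    moreover have "\<exists>y. b = v y" for b
      using permutes_surj[OF v] by (rule surjD)
    ultimately have "(a, b) \<in> ?D \<longleftrightarrow> (a, b) \<in> ?D'" for a b
      by metis
    then show "?D = ?D'" by auto
  }
qed

theorem theorem4p3:
  fixes n i j m M :: nat and v v' :: "nat \<Rightarrow> nat"
  assumes "v permutes {1..n}"
    and "1 \<le> i" and "i < j" and "j \<le> n"
    and "v' = v \<circ> transpose i j"
    and "m = min (v i) (v j)" and "M = max (v i) (v j)"
  shows "odd_diagram n v = odd_diagram n v' \<longleftrightarrow>
    i mod 2 = j mod 2 \<and>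
    (\<forall>x \<in> {i + 1..j - 1}. x mod 2 = (i + 1) mod 2 \<longrightarrow> v x < m) \<and>
    (\<forall>y \<in> {j + 1..n}. y mod 2 = (j + 1) mod 2 \<longrightarrow> v y \<notin> {m..M})"
proof (cases "v i < v j")
  case True
  then show ?thesis
    using odd_diagram_transpose_eq_iff_if_less[of v n i j] assms by simp
next
  case False
  have v': "v' permutes {1..n}"
    unfolding \<open>v' = _\<close> using assms(1-4) by (intro permutes_compose permutes_swap_id) auto
  have "v i \<noteq> v j"
    using permutes_inj[OF assms(1)] \<open>i < j\<close> by (auto dest: injD)
  then have less: "v' i < v' j" and mM: "m = v' i" "M = v' j"
    using False assms(5-7) by auto
  have v: "v = v' \<circ> transpose i j"
    using assms(5) by (simp add: comp_assoc)
  have between: "v' x = v x" if "x \<in> {i + 1..j - 1}" for x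
    using that assms(5) by (auto simp: transpose_def)
  have right: "v' y = v y" if "y \<in> {j + 1..n}" for y
    using that assms(3,5) by (auto simp: transpose_def)
  \<comment> \<open>The conditions only look at positions that the exchange leaves alone, besides the unordered
    pair of exchanged values, so they read the same for \<open>v\<close> and for \<open>v'\<close>.\<close>
  show ?thesis
    using odd_diagram_transpose_eq_iff_if_less[OF v' assms(2-4) less, folded v]
      between right unfolding mM by (simp add: eq_commute[of "odd_diagram n v"])
qed

end
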